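(* Let $a,\lambda,\eta>0$ and let $x^{*}\in\mathbb{R}^n$ be any solution (global minimizer) of the problem $(FP_{a,\lambda,\eta})$. Then for every $h\in\mathbb{R}^n$ with $\mathrm{supp}(h)\subseteq\mathrm{supp}(x^{*})$, $$\frac{2}{T}\langle \beta e_T-Rx^{*},Rh\rangle+2\eta\langle b-Ax^{*},Ah\rangle=\lambda\sum_{i\in\mathrm{supp}(x^{*})}\frac{a\,h_i\,\mathrm{sign}(x_i^{*})}{(1+a|x_i^{*}|)^2}.$$
   Context: Let $T,n$ be positive integers, $r_1,\dots,r_T\in\mathbb{R}^n$ the vectors of asset returns, $R=(r_1,\dots,r_T)^\top\in\mathbb{R}^{T\times n}$, $\mu\in\mathbb{R}^n$ the (given) mean return vector, $\beta\in\mathbb{R}$, $e_m\in\mathbb{R}^m$ the vector of all ones, $A=(\mu,e_n)^\top\in\mathbb{R}^{2\times n}$, $b=(\beta,1)^\top\in\mathbb{R}^2$. For $a>0$ let $\rho_a(t)=\frac{a|t|}{a|t|+1}$ for $t\in\mathbb{R}$ and $P_a(x)=\sum_i\rho_a(x_i)$. For $\lambda,\eta>0$ the problem $(FP_{a,\lambda,\eta})$ is the minimization over $x\in\mathbb{R}^n$ of $$\frac1T\|Rx-\beta e_T\|_2^2+\lambda P_a(x)+\eta\|Ax-b\|_2^2 .$$ $\mathrm{supp}(x)=\{i: x_i\neq 0\}$. *)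

theory Defs
  imports "HOL-Analysis.Analysis"
begin

(* The index types 't and 'n play the roles of {1..T} and {1..n};
   thus T = CARD('t) and n = CARD('n). *)

definition ones :: "real ^ 'm" where
  "ones = (\<chi> i. 1)"

definition supp :: "real ^ 'n \<Rightarrow> 'n set" where
  "supp x = {i. x $ i \<noteq> 0}"

definition rho :: "real \<Rightarrow> real \<Rightarrow> real" where
  "rho a t = a * \<bar>t\<bar> / (a * \<bar>t\<bar> + 1)"

definition frac_pen :: "real \<Rightarrow> real ^ 'n \<Rightarrow> real" where
  "frac_pen a x = (\<Sum>i\<in>UNIV. rho a (x $ i))"

definition return_mat :: "('t \<Rightarrow> real ^ 'n) \<Rightarrow> real ^ 'n ^ 't" where
  "return_mat r = (\<chi> t. r t)"

definition constr_mat :: "real ^ 'n \<Rightarrow> real ^ 'n ^ 2" where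
  "constr_mat \<mu> = vector [\<mu>, ones]"

definition constr_rhs :: "real \<Rightarrow> real ^ 2" where
  "constr_rhs \<beta> = vector [\<beta>, 1]"

(* The norm of real ^ 'm is the Euclidean norm. *)
definition fp_objective ::
  "('t::finite \<Rightarrow> real ^ 'n) \<Rightarrow> real ^ 'n \<Rightarrow> real \<Rightarrow> real \<Rightarrow> real \<Rightarrow> real \<Rightarrow> real ^ 'n \<Rightarrow> real" where
  "fp_objective r \<mu> \<beta> a lam \<eta> x =
     1 / real CARD('t) * (norm (return_mat r *v x - \<beta> *\<^sub>R ones))\<^sup>2
     + lam * frac_pen a x
     + \<eta> * (norm (constr_mat \<mu> *v x - constr_rhs \<beta>))\<^sup>2"

definition fp_solution ::
  "('t::finite \<Rightarrow> real ^ 'n) \<Rightarrow> real ^ 'n \<Rightarrow> real \<Rightarrow> real \<Rightarrow> real \<Rightarrow> real \<Rightarrow> real ^ 'n \<Rightarrow> bool" where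
  "fp_solution r \<mu> \<beta> a lam \<eta> x \<longleftrightarrow> is_arg_min (fp_objective r \<mu> \<beta> a lam \<eta>) (\<lambda>_. True) x"

end

theory Submission
  imports Defs
begin

text \<open>Since \<open>supp h \<subseteq> supp x\<close>, no coordinate of \<open>x\<close> that \<open>h\<close> moves is zero, so the objective
  restricted to the line \<open>x + s h\<close> is differentiable at its minimum \<open>s = 0\<close> although \<open>rho a\<close> is not
  differentiable at 0. The identity says that this derivative vanishes.\<close>

text \<open>Expanding the square gives a quadratic polynomial in \<open>s\<close>; its linear
  coefficient is the derivative at 0.\<close>

lemma has_real_derivative_norm_line_power2:
  fixes u v :: "'a::real_inner"
  shows "((\<lambda>s. (norm (u + s *\<^sub>R v))\<^sup>2) has_real_derivative 2 * (u \<bullet> v)) (at 0)"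
proof -
  have "(norm (u + s *\<^sub>R v))\<^sup>2 = u \<bullet> u + 2 * s * (u \<bullet> v) + s\<^sup>2 * (v \<bullet> v)" for s
    unfolding power2_norm_eq_inner
    by (simp add: inner_add_left inner_add_right inner_commute power2_eq_square algebra_simps)
  then show ?thesis
    by (auto intro!: derivative_eq_intros)
qed

lemma has_real_derivative_rho:
  assumes "a > 0" and "t \<noteq> 0"
  shows "(rho a has_real_derivative a * sgn t / (1 + a * \<bar>t\<bar>)\<^sup>2) (at t)"
proof -
  have "a * \<bar>t\<bar> + 1 > 0"
    using assms by (simp add: add_nonneg_pos)
  \<comment> \<open>On the reals the norm is \<open>abs\<close>, and the inner product with
    \<open>sgn t\<close> is multiplication by \<open>sgn t\<close>.\<close>
  moreover have "(abs has_real_derivative sgn t) (at t)"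
    using has_derivative_norm[OF assms(2)]
    by (simp add: has_field_derivative_def real_norm_def[abs_def] mult_commute_abs)
  ultimately have "((\<lambda>t. a * \<bar>t\<bar> / (a * \<bar>t\<bar> + 1)) has_real_derivative
      a * sgn t / (1 + a * \<bar>t\<bar>)\<^sup>2) (at t)"
    by (auto intro!: derivative_eq_intros simp: power2_eq_square field_simps)
  then show ?thesis
    by (simp add: rho_def[abs_def])
qed

lemma has_real_derivative_frac_pen_line:
  assumes "a > 0" and "supp h \<subseteq> supp x"
  shows "((\<lambda>s. frac_pen a (x + s *\<^sub>R h)) has_real_derivative
    (\<Sum>i\<in>supp x. a * h $ i * sgn (x $ i) / (1 + a * \<bar>x $ i\<bar>)\<^sup>2)) (at 0)"
proof -
  have "((\<lambda>s. rho a (x $ i + s * h $ i)) has_real_derivative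
      (if i \<in> supp x then a * h $ i * sgn (x $ i) / (1 + a * \<bar>x $ i\<bar>)\<^sup>2 else 0)) (at 0)" for i
  proof (cases "i \<in> supp x")
    case True
    have "((\<lambda>s. x $ i + s * h $ i) has_real_derivative h $ i) (at 0)"
      by (auto intro!: derivative_eq_intros)
    \<comment> \<open>The point is left unsimplified as the inner function's value at
      \<open>s = 0\<close>, as the chain rule expects.\<close>
    moreover have "(rho a has_real_derivative a * sgn (x $ i) / (1 + a * \<bar>x $ i\<bar>)\<^sup>2)
        (at (x $ i + 0 * h $ i))"
      using has_real_derivative_rho[OF assms(1)] True by (simp add: supp_def)
    ultimately show ?thesis
      using True DERIV_chain2 by (fastforce simp: mult_ac)
  next
    case False
    \<comment> \<open>The summand is then constant in \<open>s\<close>, so the kink of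
      \<open>rho a\<close> at 0 does no harm.\<close>
    then have "h $ i = 0"
      using assms(2) by (auto simp: supp_def)
    then show ?thesis
      using False by simp
  qed
  then have "((\<lambda>s. \<Sum>i\<in>UNIV. rho a (x $ i + s * h $ i)) has_real_derivative
      (\<Sum>i\<in>UNIV. if i \<in> supp x then a * h $ i * sgn (x $ i) / (1 + a * \<bar>x $ i\<bar>)\<^sup>2 else 0)) (at 0)"
    by (intro DERIV_sum)
  then show ?thesis
    by (simp add: frac_pen_def sum.If_cases)
qed

text \<open>Serves both the return term and the constraint term; the sign is arranged so that the
  residual \<open>c - A *v x\<close> appears.\<close>

lemma has_real_derivative_residual_line:
  fixes A :: "real ^ 'n ^ 'm"
  shows "((\<lambda>s. (norm (A *v (x + s *\<^sub>R h) - c))\<^sup>2) has_real_derivative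
    - 2 * ((c - A *v x) \<bullet> (A *v h))) (at 0)"
proof -
  have line: "A *v (x + s *\<^sub>R h) - c = (A *v x - c) + s *\<^sub>R (A *v h)" for s
    by (simp add: matrix_vector_right_distrib matrix_vector_mult_scaleR)
  have "- 2 * ((c - A *v x) \<bullet> (A *v h)) = 2 * ((A *v x - c) \<bullet> (A *v h))"
    by (simp add: inner_diff_left)
  then show ?thesis
    unfolding line by (simp only: has_real_derivative_norm_line_power2)
qed

theorem theorem1:
  fixes r :: "'t::finite \<Rightarrow> real ^ 'n" and \<mu> :: "real ^ 'n"
    and \<beta> a lam \<eta> :: real and x h :: "real ^ 'n"
  assumes "a > 0" and "lam > 0" and "\<eta> > 0"
    and "fp_solution r \<mu> \<beta> a lam \<eta> x"
    and "supp h \<subseteq> supp x"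
  shows "2 / real CARD('t) * ((\<beta> *\<^sub>R ones - return_mat r *v x) \<bullet> (return_mat r *v h))
       + 2 * \<eta> * ((constr_rhs \<beta> - constr_mat \<mu> *v x) \<bullet> (constr_mat \<mu> *v h))
       = lam * (\<Sum>i\<in>supp x. a * h $ i * sgn (x $ i) / (1 + a * \<bar>x $ i\<bar>)\<^sup>2)"
    (is "2 / _ * ?p + 2 * \<eta> * ?q = lam * ?S")
proof -
  have "((\<lambda>s. fp_objective r \<mu> \<beta> a lam \<eta> (x + s *\<^sub>R h)) has_real_derivative
      1 / real CARD('t) * (- 2 * ?p) + lam * ?S + \<eta> * (- 2 * ?q)) (at 0)"
    unfolding fp_objective_def
    by (intro DERIV_add DERIV_cmult has_real_derivative_residual_line
        has_real_derivative_frac_pen_line assms)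
  moreover have "fp_objective r \<mu> \<beta> a lam \<eta> (x + 0 *\<^sub>R h) \<le> fp_objective r \<mu> \<beta> a lam \<eta> (x + s *\<^sub>R h)"
    for s
    using assms(4) by (simp add: fp_solution_def is_arg_min_linorder)
  \<comment> \<open>Fermat's rule asks for minimality only within some radius of 0; as the minimum
    is global, radius 1 serves as well as any.\<close>
  ultimately have "1 / real CARD('t) * (- 2 * ?p) + lam * ?S + \<eta> * (- 2 * ?q) = 0"
    using DERIV_local_min[OF _ zero_less_one] by blast
  then show ?thesis
    by (simp add: algebra_simps)
qed

end
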